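(* Let $\eta=(\eta_t)_{t\ge0}$ be the continuous centered Gaussian process with covariance $$E\eta_s\eta_t=R(s,t)=-\left(s^2\log s+t^2\log t-\frac12\left[(s+t)^2\log(s+t)+(s-t)^2\log|s-t|\right]\right),\qquad s,t\ge0.$$ Then $\eta$ is not a semimartingale.
   Context: The convention $0^2\log 0=0$ is used. The function $R$ is known to be positive-definite, and the corresponding centered Gaussian process has a version with continuous paths, which is the one considered. The semimartingale property is understood with respect to the natural filtration of the process. *)

theory Defs
  imports "HOL-Probability.Probability"
begin

text \<open>
  Stochastic processes are functions \<open>X :: real \<Rightarrow> 'a \<Rightarrow> real\<close>, of which only the values at
  times \<open>t \<ge> 0\<close> matter. Filtrations are families \<open>F :: real \<Rightarrow> 'a measure\<close> in the sense of the
  locale \<^locale>\<open>filtration\<close>, and only their \<open>\<sigma>\<close>-algebras matter, not the measures they carry.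
\<close>

subsection \<open>Gaussian processes\<close>

text \<open>Constants are included as degenerate Gaussian variables.\<close>

definition gaussian_rv :: "'a measure \<Rightarrow> ('a \<Rightarrow> real) \<Rightarrow> bool" where
  "gaussian_rv M Y \<longleftrightarrow> Y \<in> borel_measurable M \<and>
     ((\<exists>\<mu> \<sigma>. \<sigma> > 0 \<and> distributed M lborel Y (normal_density \<mu> \<sigma>)) \<or>
      (\<exists>\<mu>. AE \<omega> in M. Y \<omega> = \<mu>))"

definition gaussian_process :: "'a measure \<Rightarrow> (real \<Rightarrow> 'a \<Rightarrow> real) \<Rightarrow> bool" where
  "gaussian_process M X \<longleftrightarrow>
     (\<forall>S c. finite S \<and> S \<subseteq> {0..} \<longrightarrow> gaussian_rv M (\<lambda>\<omega>. \<Sum>t\<in>S. c t * X t \<omega>))"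

definition centered_gaussian_process ::
    "'a measure \<Rightarrow> (real \<Rightarrow> 'a \<Rightarrow> real) \<Rightarrow> (real \<Rightarrow> real \<Rightarrow> real) \<Rightarrow> bool" where
  "centered_gaussian_process M X C \<longleftrightarrow> gaussian_process M X \<and>
     (\<forall>t\<ge>0. integral\<^sup>L M (X t) = 0) \<and>
     (\<forall>s\<ge>0. \<forall>t\<ge>0. integral\<^sup>L M (\<lambda>\<omega>. X s \<omega> * X t \<omega>) = C s t)"

text \<open>The convention \<open>0\<^sup>2 log 0 = 0\<close> holds automatically because of the factor \<open>0\<^sup>2\<close>.\<close>

definition R :: "real \<Rightarrow> real \<Rightarrow> real" where
  "R s t = - (s\<^sup>2 * ln s + t\<^sup>2 * ln t
      - 1 / 2 * ((s + t)\<^sup>2 * ln (s + t) + (s - t)\<^sup>2 * ln \<bar>s - t\<bar>))"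


subsection \<open>Semimartingales\<close>

definition natural_filtration :: "'a measure \<Rightarrow> (real \<Rightarrow> 'a \<Rightarrow> real) \<Rightarrow> real \<Rightarrow> 'a measure" where
  "natural_filtration M X t =
     sigma (space M) (\<Union>s\<in>{0..t}. {X s -` B \<inter> space M | B. B \<in> sets borel})"

lemma sets_natural_filtration:
  "sets (natural_filtration M X t) =
     sigma_sets (space M) (\<Union>s\<in>{0..t}. {X s -` B \<inter> space M | B. B \<in> sets borel})"
  unfolding natural_filtration_def by (rule sets_measure_of) blast

lemma space_natural_filtration: "space (natural_filtration M X t) = space M"
  unfolding natural_filtration_def by (rule space_measure_of) blast

lemma filtration_natural_filtration: "filtration (space M) (natural_filtration M X)"
proof
  fix i j :: real
  assume "i \<le> j"
  then have "{0..i} \<subseteq> {0..j}"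
    by simp
  then show "sets (natural_filtration M X i) \<subseteq> sets (natural_filtration M X j)"
    unfolding sets_natural_filtration by (intro sigma_sets_mono' UN_mono order_refl)
qed (rule space_natural_filtration)

lemma subalgebra_natural_filtration:
  assumes "\<And>s. s \<ge> 0 \<Longrightarrow> X s \<in> borel_measurable M"
  shows "subalgebra M (natural_filtration M X t)"
proof -
  have "(\<Union>s\<in>{0..t}. {X s -` B \<inter> space M | B. B \<in> sets borel}) \<subseteq> sets M"
    using measurable_sets[OF assms] by force
  then show ?thesis
    unfolding subalgebra_def sets_natural_filtration space_natural_filtration
    using sets.sigma_sets_subset by blast
qed

definition adapted :: "(real \<Rightarrow> 'a measure) \<Rightarrow> (real \<Rightarrow> 'a \<Rightarrow> real) \<Rightarrow> bool" where
  "adapted F X \<longleftrightarrow> (\<forall>t\<ge>0. X t \<in> borel_measurable (F t))"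

definition cadlag :: "(real \<Rightarrow> real) \<Rightarrow> bool" where
  "cadlag x \<longleftrightarrow> (\<forall>t\<ge>0. (x \<longlongrightarrow> x t) (at_right t)) \<and> (\<forall>t>0. \<exists>l. (x \<longlongrightarrow> l) (at_left t))"

definition finite_variation :: "(real \<Rightarrow> real) \<Rightarrow> bool" where
  "finite_variation x \<longleftrightarrow> (\<forall>T\<ge>0. \<exists>B. \<forall>(u :: nat \<Rightarrow> real) n.
     incseq u \<and> range u \<subseteq> {0..T} \<longrightarrow> (\<Sum>i<n. \<bar>x (u (Suc i)) - x (u i)\<bar>) \<le> B)"

definition martingale ::
    "'a measure \<Rightarrow> (real \<Rightarrow> 'a measure) \<Rightarrow> (real \<Rightarrow> 'a \<Rightarrow> real) \<Rightarrow> bool" where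
  "martingale M F X \<longleftrightarrow> adapted F X \<and> (\<forall>t\<ge>0. integrable M (X t)) \<and>
     (\<forall>s t. 0 \<le> s \<and> s \<le> t \<longrightarrow> (AE \<omega> in M. real_cond_exp M (F s) (X t) \<omega> = X s \<omega>))"

text \<open>
  Taking the localizing stopping times to be finite loses no generality: a localizing sequence
  \<open>\<tau>\<^sub>n\<close> with values in \<open>[0, \<infinity>]\<close> can be replaced by \<open>min \<tau>\<^sub>n n\<close>. Subtracting \<open>L 0\<close> means that no
  integrability of the initial value is required.
\<close>

definition local_martingale ::
    "'a measure \<Rightarrow> (real \<Rightarrow> 'a measure) \<Rightarrow> (real \<Rightarrow> 'a \<Rightarrow> real) \<Rightarrow> bool" where
  "local_martingale M F L \<longleftrightarrow> adapted F L \<and> (AE \<omega> in M. cadlag (\<lambda>t. L t \<omega>)) \<and>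
     (\<exists>\<tau> :: nat \<Rightarrow> 'a \<Rightarrow> real.
        (\<forall>n. stopping_time F (\<tau> n)) \<and> (\<forall>n. \<forall>\<omega>\<in>space M. 0 \<le> \<tau> n \<omega>) \<and>
        (AE \<omega> in M. incseq (\<lambda>n. \<tau> n \<omega>) \<and> filterlim (\<lambda>n. \<tau> n \<omega>) at_top sequentially) \<and>
        (\<forall>n. martingale M F (\<lambda>t \<omega>. L (min t (\<tau> n \<omega>)) \<omega> - L 0 \<omega>)))"

definition semimartingale ::
    "'a measure \<Rightarrow> (real \<Rightarrow> 'a measure) \<Rightarrow> (real \<Rightarrow> 'a \<Rightarrow> real) \<Rightarrow> bool" where
  "semimartingale M F X \<longleftrightarrow> adapted F X \<and> (AE \<omega> in M. cadlag (\<lambda>t. X t \<omega>)) \<and>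
     (\<exists>L A. local_martingale M F L \<and>
        adapted F A \<and> (AE \<omega> in M. cadlag (\<lambda>t. A t \<omega>) \<and> finite_variation (\<lambda>t. A t \<omega>)) \<and>
        (AE \<omega> in M. \<forall>t\<ge>0. X t \<omega> = L t \<omega> + A t \<omega>))"

end

theory Submission
  imports Defs
begin

text \<open>
  On the grid of mesh \<open>h = 1/(n+1)\<close> in \<open>[1, 2]\<close> the increments of \<open>\<eta>\<close> have variance at least
  \<open>h\<^sup>2 ln (1/h)\<close>, since \<open>x\<^sup>2 ln x\<close> is convex on \<open>[1, \<infinity>)\<close>, while the second differences have
  variance \<open>O(h\<^sup>2)\<close>, because the logarithms cancel. Integrating the sign of the preceding increment
  against \<open>\<eta>\<close> therefore gives the sum of the absolute increments up to an error bounded in \<open>L\<^sup>1\<close>.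
  That sum consists of centered Gaussian variables whose standard deviations add up to at least
  \<open>sqrt (ln n) / 2\<close>, so it is not bounded in probability. But the integrals of predictable step
  processes bounded by 1 against a semimartingale are bounded in probability: trivially for the
  finite variation part, and by the weak type inequality for martingale transforms for the
  stopped local martingale part.
\<close>

subsection \<open>Martingale transforms\<close>

text \<open>
  Burkholder's special function for the weak type inequality: it majorizes
  \<open>1{\<bar>y\<bar> \<ge> 1} - 2 \<bar>x\<bar>\<close>, and along a martingale \<open>x\<close> and its transform \<open>y\<close> it is a supermartingale.
\<close>

definition burkholder :: "real \<Rightarrow> real \<Rightarrow> real" where
  "burkholder x y = (if \<bar>x\<bar> + \<bar>y\<bar> \<le> 1 then y\<^sup>2 - x\<^sup>2 else 1 - 2 * \<bar>x\<bar>)"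

lemma burkholder_measurable [measurable (raw)]:
  assumes [measurable]: "f \<in> borel_measurable N" "g \<in> borel_measurable N"
  shows "(\<lambda>\<omega>. burkholder (f \<omega>) (g \<omega>)) \<in> borel_measurable N"
  unfolding burkholder_def by measurable

text \<open>On the diamond, |y| <= 1 - |x| squares to y^2 - x^2 <= 1 - 2|x|, so the outer formula
  dominates everywhere.\<close>

lemma burkholder_le: "burkholder x y \<le> 1 - 2 * \<bar>x\<bar>"
proof (cases "\<bar>x\<bar> + \<bar>y\<bar> \<le> 1")
  case True
  then have "\<bar>y\<bar>\<^sup>2 \<le> (1 - \<bar>x\<bar>)\<^sup>2"
    by (intro power_mono) auto
  with True show ?thesis
    by (simp add: burkholder_def power2_diff)
qed (simp add: burkholder_def)

text \<open>Only the diamond needs an argument: there |x| <= 1 gives x^2 <= |x|, while y^2 dominates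
  the indicator of |y| >= 1.\<close>

lemma burkholder_ge: "(if 1 \<le> \<bar>y\<bar> then 1 else 0) - 2 * \<bar>x\<bar> \<le> burkholder x y"
proof (cases "\<bar>x\<bar> + \<bar>y\<bar> \<le> 1")
  case True
  have "\<bar>x\<bar>\<^sup>2 \<le> \<bar>x\<bar>"
    using True unfolding power2_eq_square by (intro mult_left_le) auto
  moreover have "(if 1 \<le> \<bar>y\<bar> then 1 else 0) \<le> y\<^sup>2"
    using one_le_power[of "\<bar>y\<bar>" 2] by simp
  moreover have "burkholder x y = y\<^sup>2 - x\<^sup>2"
    using True by (simp add: burkholder_def)
  ultimately show ?thesis
    using abs_ge_zero[of x] unfolding power2_abs by linarith
qed (auto simp: burkholder_def)

text \<open>Linear growth in \<open>x\<close>, uniformly in \<open>y\<close>: integrability of the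
  special function along the pair follows from that of the martingale alone.\<close>

lemma abs_burkholder_le: "\<bar>burkholder x y\<bar> \<le> 1 + 2 * \<bar>x\<bar>"
  using burkholder_le[of x y] burkholder_ge[of y x] by (auto split: if_splits)

text \<open>The correction is the differential of the branch active at (x, y), hence linear in the
  increments. If \<open>k\<close> is a predictable multiple of the martingale increment
  \<open>h\<close>, it has mean zero, which yields the supermartingale property.\<close>

lemma burkholder_step:
  assumes "\<bar>k\<bar> \<le> \<bar>h\<bar>"
  shows "burkholder (x + h) (y + k) \<le> burkholder x y +
    (if \<bar>x\<bar> + \<bar>y\<bar> \<le> 1 then 2 * y * k - 2 * x * h else - 2 * sgn x * h)"
proof (cases "\<bar>x\<bar> + \<bar>y\<bar> \<le> 1")
  case inside: True
  have k2: "k\<^sup>2 \<le> h\<^sup>2"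
    using assms by (simp add: abs_le_square_iff)
  \<comment> \<open>The right-hand side expands exactly to y^2 - x^2 plus the linear correction, so
    what remains is a comparison at the new point, with the nonnegative reserve h^2 - k^2.\<close>
  have "burkholder (x + h) (y + k) \<le> (y + k)\<^sup>2 - (x + h)\<^sup>2 + (h\<^sup>2 - k\<^sup>2)"
  proof (cases "\<bar>x + h\<bar> + \<bar>y + k\<bar> \<le> 1")
    case False
    show ?thesis
    proof (cases "\<bar>x + h\<bar> \<le> 1")
      case True
      then have "(1 - \<bar>x + h\<bar>)\<^sup>2 \<le> \<bar>y + k\<bar>\<^sup>2"
        using False by (intro power_mono) auto
      then have "1 - 2 * \<bar>x + h\<bar> \<le> (y + k)\<^sup>2 - (x + h)\<^sup>2"
        by (simp add: power2_diff)
      then show ?thesis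
        using False k2 by (simp add: burkholder_def)
    next
      case out: False
      \<comment> \<open>From |x| + |y| <= 1 < |x + h| one gets 0 <= |x + h| - 1 <= |h| - |y|, so
        squaring preserves the order.\<close>
      have "(\<bar>x + h\<bar> - 1)\<^sup>2 \<le> (\<bar>h\<bar> - \<bar>y\<bar>)\<^sup>2"
        using out inside by (intro power_mono) auto
      also have "\<dots> = h\<^sup>2 + y\<^sup>2 - 2 * (\<bar>h\<bar> * \<bar>y\<bar>)"
        by (simp add: power2_diff)
      also have "\<dots> \<le> h\<^sup>2 + y\<^sup>2 + 2 * (k * y)"
      proof -
        have "\<bar>k\<bar> * \<bar>y\<bar> \<le> \<bar>h\<bar> * \<bar>y\<bar>"
          using assms by (intro mult_right_mono) auto
        moreover have "- (k * y) \<le> \<bar>k\<bar> * \<bar>y\<bar>"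
          using abs_ge_minus_self[of "k * y"] by (simp add: abs_mult)
        ultimately show ?thesis by linarith
      qed
      also have "\<dots> = (y + k)\<^sup>2 + (h\<^sup>2 - k\<^sup>2)"
        by (simp add: power2_sum algebra_simps)
      finally have "1 - 2 * \<bar>x + h\<bar> \<le> (y + k)\<^sup>2 - (x + h)\<^sup>2 + (h\<^sup>2 - k\<^sup>2)"
        by (simp add: power2_diff)
      then show ?thesis
        using False by (simp add: burkholder_def)
    qed
  qed (use k2 in \<open>simp add: burkholder_def\<close>)
  also have "\<dots> = y\<^sup>2 - x\<^sup>2 + (2 * y * k - 2 * x * h)"
    by (simp add: power2_eq_square algebra_simps)
  finally show ?thesis
    using inside by (simp add: burkholder_def)
next
  case False
  \<comment> \<open>Convexity of the absolute value; \<open>sgn 0 = 0\<close> covers x = 0. Then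
    \<open>burkholder_le\<close> bounds the value at the new point whichever branch applies
    there.\<close>
  have "\<bar>x\<bar> + sgn x * h \<le> \<bar>x + h\<bar>"
    by (auto simp: sgn_if)
  then show ?thesis
    using False burkholder_le[of "x + h" "y + k"] by (simp add: burkholder_def)
qed

text \<open>A bounded \<open>F\<close>-measurable factor can be taken inside the conditional
  expectation. For consecutive values of a martingale this says that predictable multiples of the
  increment have mean zero.\<close>

lemma (in prob_space) integral_mult_cond_exp:
  fixes g X Y :: "'a \<Rightarrow> real"
  assumes sub: "subalgebra M F" and g: "g \<in> borel_measurable F" and bound: "\<And>\<omega>. \<bar>g \<omega>\<bar> \<le> C"
    and X: "integrable M X" and Y: "integrable M Y"
    and eq: "AE \<omega> in M. real_cond_exp M F Y \<omega> = X \<omega>"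
  shows "integrable M (\<lambda>\<omega>. g \<omega> * X \<omega>)" "integrable M (\<lambda>\<omega>. g \<omega> * Y \<omega>)"
    "expectation (\<lambda>\<omega>. g \<omega> * X \<omega>) = expectation (\<lambda>\<omega>. g \<omega> * Y \<omega>)"
proof -
  interpret finite_measure_subalgebra M F
    by unfold_locales (rule sub)
  have [measurable]: "g \<in> borel_measurable M" "X \<in> borel_measurable M" "Y \<in> borel_measurable M"
    using measurable_from_subalg[OF sub g] X Y by auto
  have *: "integrable M (\<lambda>\<omega>. g \<omega> * Z \<omega>)" if Z: "integrable M Z" for Z :: "'a \<Rightarrow> real"
  proof (rule Bochner_Integration.integrable_bound)
    show "integrable M (\<lambda>\<omega>. C * Z \<omega>)"
      using Z by simp
    have "\<bar>g \<omega>\<bar> * \<bar>Z \<omega>\<bar> \<le> \<bar>C\<bar> * \<bar>Z \<omega>\<bar>" for \<omega>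
      using bound[of \<omega>] by (intro mult_right_mono) auto
    then show "AE \<omega> in M. norm (g \<omega> * Z \<omega>) \<le> norm (C * Z \<omega>)"
      by (simp add: abs_mult)
  qed (use Z in measurable)
  show "integrable M (\<lambda>\<omega>. g \<omega> * X \<omega>)" and gY: "integrable M (\<lambda>\<omega>. g \<omega> * Y \<omega>)"
    using * X Y by auto
  have "expectation (\<lambda>\<omega>. g \<omega> * X \<omega>) = expectation (\<lambda>\<omega>. g \<omega> * real_cond_exp M F Y \<omega>)"
    by (rule integral_cong_AE) (use eq in \<open>auto\<close>)
  also have "\<dots> = expectation (\<lambda>\<omega>. g \<omega> * Y \<omega>)"
    by (rule real_cond_exp_intg(2)[OF gY g]) simp
  finally show "expectation (\<lambda>\<omega>. g \<omega> * X \<omega>) = expectation (\<lambda>\<omega>. g \<omega> * Y \<omega>)" .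
qed

text \<open>Conditional Jensen for the absolute value, obtained by testing with the
  \<open>F\<close>-measurable sign of \<open>X\<close>.\<close>

lemma (in prob_space) expectation_abs_cond_exp_le:
  fixes X Y :: "'a \<Rightarrow> real"
  assumes "subalgebra M F" "X \<in> borel_measurable F" "integrable M X" "integrable M Y"
    and "AE \<omega> in M. real_cond_exp M F Y \<omega> = X \<omega>"
  shows "expectation (\<lambda>\<omega>. \<bar>X \<omega>\<bar>) \<le> expectation (\<lambda>\<omega>. \<bar>Y \<omega>\<bar>)"
proof -
  have g: "(\<lambda>\<omega>. sgn (X \<omega>)) \<in> borel_measurable F"
    using assms(2) by measurable
  have b: "\<bar>sgn (X \<omega>)\<bar> \<le> 1" for \<omega>
    by (simp add: sgn_if)
  note * = integral_mult_cond_exp[OF assms(1) g b assms(3-5)]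
  have "expectation (\<lambda>\<omega>. \<bar>X \<omega>\<bar>) = expectation (\<lambda>\<omega>. sgn (X \<omega>) * X \<omega>)"
    by (intro Bochner_Integration.integral_cong) (auto simp: sgn_if)
  also have "\<dots> = expectation (\<lambda>\<omega>. sgn (X \<omega>) * Y \<omega>)"
    by (rule *(3))
  also have "\<dots> \<le> expectation (\<lambda>\<omega>. \<bar>Y \<omega>\<bar>)"
    using *(2) assms(4) by (intro integral_mono) (auto simp: sgn_if)
  finally show ?thesis .
qed

text \<open>Divided by \<open>K\<close> and started at the origin, the martingale and its transform
  keep the expectation of \<open>burkholder\<close> nonpositive; the majorization at time
  \<open>n\<close> turns this into the probability bound.\<close>

lemma (in prob_space) martingale_transform_weak_type:
  fixes X H :: "nat \<Rightarrow> 'a \<Rightarrow> real"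
  assumes sub: "\<And>i. subalgebra M (F i)" and mono: "\<And>i. subalgebra (F (Suc i)) (F i)"
    and X: "\<And>i. X i \<in> borel_measurable (F i)" and int: "\<And>i. integrable M (X i)"
    and mart: "\<And>i. AE \<omega> in M. real_cond_exp M (F i) (X (Suc i)) \<omega> = X i \<omega>"
    and H: "\<And>i. H i \<in> borel_measurable (F i)" and H1: "\<And>i \<omega>. \<bar>H i \<omega>\<bar> \<le> 1"
    and K: "K > 0"
  shows "prob {\<omega> \<in> space M. K \<le> \<bar>\<Sum>i<n. H i \<omega> * (X (Suc i) \<omega> - X i \<omega>)\<bar>}
           \<le> 2 * expectation (\<lambda>\<omega>. \<bar>X n \<omega> - X 0 \<omega>\<bar>) / K"
proof -
  define x where "x n \<omega> = (X n \<omega> - X 0 \<omega>) / K" for n \<omega>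
  define y where "y n \<omega> = (\<Sum>i<n. H i \<omega> * (X (Suc i) \<omega> - X i \<omega>)) / K" for n \<omega>
  have X0: "X 0 \<in> borel_measurable (F n)" for n
    by (induction n) (auto intro: X measurable_from_subalg[OF mono])
  have x: "x n \<in> borel_measurable (F n)" for n
    unfolding x_def using X X0 by measurable
  have y_Suc: "y (Suc n) \<omega> = y n \<omega> + H n \<omega> * (x (Suc n) \<omega> - x n \<omega>)" for n \<omega>
    by (simp add: x_def y_def add_divide_distrib diff_divide_distrib[symmetric])
  have y: "y n \<in> borel_measurable (F n)" for n
  proof (induction n)
    case 0
    then show ?case by (simp add: y_def)
  next
    case (Suc n)
    then have "y n \<in> borel_measurable (F (Suc n))" "x n \<in> borel_measurable (F (Suc n))"
      "H n \<in> borel_measurable (F (Suc n))"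
      using x H by (auto intro: measurable_from_subalg[OF mono])
    then show ?case
      using x[of "Suc n"] unfolding y_Suc[abs_def] by measurable
  qed
  have [measurable]: "x n \<in> borel_measurable M" "y n \<in> borel_measurable M" for n
    using x y by (auto intro: measurable_from_subalg[OF sub])
  have x_int: "integrable M (x n)" for n
    unfolding x_def using int by auto
  have U_int: "integrable M (\<lambda>\<omega>. burkholder (x n \<omega>) (y n \<omega>))" for n
    by (rule Bochner_Integration.integrable_bound[where f = "\<lambda>\<omega>. 1 + 2 * \<bar>x n \<omega>\<bar>"])
      (use x_int abs_burkholder_le in auto)
  have U_le: "expectation (\<lambda>\<omega>. burkholder (x n \<omega>) (y n \<omega>)) \<le> 0" for n
  proof (induction n)
    case 0
    then show ?case
      by (simp add: x_def y_def burkholder_def)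
  next
    case (Suc n)
    \<comment> \<open>Coefficient of the martingale increment in the linear term of
      \<open>burkholder_step\<close>, with the increment of the transform written as
      \<open>H n\<close> times that of \<open>x\<close>. It is bounded because the first branch is
      confined to the diamond.\<close>
    define g where "g \<omega> = (if \<bar>x n \<omega>\<bar> + \<bar>y n \<omega>\<bar> \<le> 1 then 2 * y n \<omega> * H n \<omega> - 2 * x n \<omega>
      else - 2 * sgn (x n \<omega>))" for \<omega>
    have g: "(\<lambda>\<omega>. g \<omega> / K) \<in> borel_measurable (F n)"
      unfolding g_def using x[of n] y[of n] H[of n] by measurable
    have gb: "\<bar>g \<omega> / K\<bar> \<le> 4 / K" for \<omega>
    proof -
      have "\<bar>y n \<omega> * H n \<omega>\<bar> \<le> \<bar>y n \<omega>\<bar>"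
        using H1[of n \<omega>] by (simp add: abs_mult mult_left_le)
      then have "\<bar>g \<omega>\<bar> \<le> 4"
        by (auto simp: g_def sgn_if)
      then show ?thesis
        using K by (simp add: divide_right_mono)
    qed
    note * = integral_mult_cond_exp[OF sub g gb int int mart]
    have eq: "g \<omega> * (x (Suc n) \<omega> - x n \<omega>) = g \<omega> / K * X (Suc n) \<omega> - g \<omega> / K * X n \<omega>" for \<omega>
      by (simp add: x_def diff_divide_distrib algebra_simps)
    have g_int: "integrable M (\<lambda>\<omega>. g \<omega> * (x (Suc n) \<omega> - x n \<omega>))"
      unfolding eq using *(1,2) by (rule Bochner_Integration.integrable_diff[rotated])
    have g0: "expectation (\<lambda>\<omega>. g \<omega> * (x (Suc n) \<omega> - x n \<omega>)) = 0"
      unfolding eq using * by (subst Bochner_Integration.integral_diff) auto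
    have step: "burkholder (x (Suc n) \<omega>) (y (Suc n) \<omega>)
        \<le> burkholder (x n \<omega>) (y n \<omega>) + g \<omega> * (x (Suc n) \<omega> - x n \<omega>)" for \<omega>
    proof -
      define h where "h = x (Suc n) \<omega> - x n \<omega>"
      have "\<bar>H n \<omega> * h\<bar> \<le> \<bar>h\<bar>"
        using H1[of n \<omega>] by (simp add: abs_mult mult_left_le_one_le)
      from burkholder_step[OF this, of "x n \<omega>" "y n \<omega>"] show ?thesis
        unfolding y_Suc h_def[symmetric] by (simp add: g_def h_def algebra_simps split: if_splits)
    qed
    have "expectation (\<lambda>\<omega>. burkholder (x (Suc n) \<omega>) (y (Suc n) \<omega>))
        \<le> expectation (\<lambda>\<omega>. burkholder (x n \<omega>) (y n \<omega>) + g \<omega> * (x (Suc n) \<omega> - x n \<omega>))"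
      by (intro integral_mono step U_int Bochner_Integration.integrable_add g_int)
    also have "\<dots> = expectation (\<lambda>\<omega>. burkholder (x n \<omega>) (y n \<omega>))"
      using g0 by (subst Bochner_Integration.integral_add[OF U_int g_int]) simp
    finally show ?case
      using Suc by simp
  qed
  let ?E = "{\<omega> \<in> space M. 1 \<le> \<bar>y n \<omega>\<bar>}"
  have "prob ?E = expectation (indicator ?E)"
    by simp
  also have "\<dots> \<le> expectation (\<lambda>\<omega>. burkholder (x n \<omega>) (y n \<omega>) + 2 * \<bar>x n \<omega>\<bar>)"
  proof (intro integral_mono)
    fix \<omega> assume "\<omega> \<in> space M"
    then show "indicator ?E \<omega> \<le> burkholder (x n \<omega>) (y n \<omega>) + 2 * \<bar>x n \<omega>\<bar>"
      using burkholder_ge[of "y n \<omega>" "x n \<omega>"] by (auto simp: indicator_def split: if_splits)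
  qed (use U_int x_int in \<open>auto simp: emeasure_eq_measure\<close>)
  also have "\<dots> = expectation (\<lambda>\<omega>. burkholder (x n \<omega>) (y n \<omega>)) + 2 * expectation (\<lambda>\<omega>. \<bar>x n \<omega>\<bar>)"
    using U_int x_int by (subst Bochner_Integration.integral_add) auto
  also have "\<dots> \<le> 2 * expectation (\<lambda>\<omega>. \<bar>x n \<omega>\<bar>)"
    using U_le by simp
  also have "\<dots> = 2 * expectation (\<lambda>\<omega>. \<bar>X n \<omega> - X 0 \<omega>\<bar>) / K"
    using K by (simp add: x_def)
  also have "?E = {\<omega> \<in> space M. K \<le> \<bar>\<Sum>i<n. H i \<omega> * (X (Suc i) \<omega> - X i \<omega>)\<bar>}"
    using K by (auto simp: y_def)
  finally show ?thesis .
qed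

subsection \<open>Tightness of stochastic integrals\<close>

text \<open>Dominated convergence for the indicators, with majorant 1.\<close>

lemma (in prob_space) prob_tendsto_0:
  assumes [measurable]: "\<And>n. E n \<in> events"
    and ae: "AE \<omega> in M. eventually (\<lambda>n. \<omega> \<notin> E n) sequentially"
  shows "(\<lambda>n. prob (E n)) \<longlonglongrightarrow> 0"
proof -
  have "(\<lambda>n. expectation (indicator (E n) :: 'a \<Rightarrow> real)) \<longlonglongrightarrow> expectation (\<lambda>_. 0)"
  proof (rule integral_dominated_convergence[where w = "\<lambda>_. 1"])
    show "AE \<omega> in M. (\<lambda>n. indicator (E n) \<omega> :: real) \<longlonglongrightarrow> 0"
      using ae
    proof eventually_elim
      case (elim \<omega>)
      then have "eventually (\<lambda>n. indicator (E n) \<omega> = (0 :: real)) sequentially"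
        by eventually_elim simp
      then show ?case
        by (rule tendsto_eventually)
    qed
  qed (auto simp: indicator_def)
  then show ?thesis by simp
qed

text \<open>Three exceptional events of probability at most \<open>\<epsilon> / 3\<close> each are
  discarded: localization before \<open>T\<close>, a large transform of the stopped martingale, and
  a large variation of \<open>A\<close>. None of the three bounds depends on the grid, so
  \<open>K\<close> is uniform in \<open>n\<close>.\<close>

lemma semimartingale_integrals_tight:
  fixes M :: "'a measure" and X :: "real \<Rightarrow> 'a \<Rightarrow> real"
    and t :: "nat \<Rightarrow> nat \<Rightarrow> real" and H :: "nat \<Rightarrow> nat \<Rightarrow> 'a \<Rightarrow> real"
  assumes "prob_space M" and filt: "filtration (space M) F" and sub: "\<And>s. subalgebra M (F s)"
    and semi: "semimartingale M F X"
    and t: "\<And>n. mono (t n)" "\<And>n i. t n i \<in> {0..T}"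
    and H: "\<And>n i. H n i \<in> borel_measurable (F (t n i))" "\<And>n i \<omega>. \<bar>H n i \<omega>\<bar> \<le> 1"
    and \<epsilon>: "\<epsilon> > 0"
  obtains K where "K > 0"
    "\<And>n. measure M {\<omega> \<in> space M.
        K \<le> \<bar>\<Sum>i<N n. H n i \<omega> * (X (t n (Suc i)) \<omega> - X (t n i) \<omega>)\<bar>} \<le> \<epsilon>"
proof -
  interpret prob_space M by fact
  interpret filtration "space M" F by fact
  have T: "T \<ge> 0"
    using t(2)[of 0 0] by simp
  have t0: "t n i \<ge> 0" "t n i \<le> T" for n i
    using t(2)[of n i] by auto
  obtain L A where LA: "local_martingale M F L" "adapted F A" "adapted F X"
    and FV: "AE \<omega> in M. cadlag (\<lambda>t. A t \<omega>) \<and> finite_variation (\<lambda>t. A t \<omega>)"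
    and XLA: "AE \<omega> in M. \<forall>t\<ge>0. X t \<omega> = L t \<omega> + A t \<omega>"
    using semi unfolding semimartingale_def by blast
  obtain \<tau> :: "nat \<Rightarrow> 'a \<Rightarrow> real" where \<tau>: "\<And>n. stopping_time F (\<tau> n)"
    "AE \<omega> in M. incseq (\<lambda>n. \<tau> n \<omega>) \<and> filterlim (\<lambda>n. \<tau> n \<omega>) at_top sequentially"
    "\<And>n. martingale M F (\<lambda>t \<omega>. L (min t (\<tau> n \<omega>)) \<omega> - L 0 \<omega>)"
    using LA(1) unfolding local_martingale_def by blast
  have meas_M [measurable]: "X (t n i) \<in> borel_measurable M" "A (t n i) \<in> borel_measurable M"
    "H n i \<in> borel_measurable M" for n i
    using LA(2,3) t0 H(1) measurable_from_subalg[OF sub] unfolding adapted_def by blast+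

  have \<tau>_ev [measurable]: "{\<omega> \<in> space M. \<tau> m \<omega> \<le> T} \<in> events" for m
    using stopping_timeD[OF \<tau>(1)[of m], of T] sub[of T]
    by (auto simp: pred_def subalgebra_def)
  have "(\<lambda>m. prob {\<omega> \<in> space M. \<tau> m \<omega> \<le> T}) \<longlonglongrightarrow> 0"
  proof (rule prob_tendsto_0[OF \<tau>_ev])
    show "AE \<omega> in M. eventually (\<lambda>m. \<omega> \<notin> {\<omega> \<in> space M. \<tau> m \<omega> \<le> T}) sequentially"
      using \<tau>(2)
    proof eventually_elim
      case (elim \<omega>)
      then have "eventually (\<lambda>m. T < \<tau> m \<omega>) sequentially"
        by (auto simp: filterlim_at_top_dense)
      then show ?case
        by eventually_elim auto
    qed
  qed
  then have "eventually (\<lambda>m. prob {\<omega> \<in> space M. \<tau> m \<omega> \<le> T} < \<epsilon> / 3) sequentially"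
    using \<epsilon> by (intro order_tendstoD(2)) auto
  then obtain m where m: "prob {\<omega> \<in> space M. \<tau> m \<omega> \<le> T} < \<epsilon> / 3"
    by (auto simp: eventually_sequentially)

  \<comment> \<open>Variation of \<open>A\<close> along the grids only. On almost every path it is
    bounded uniformly in \<open>n\<close>, and the event that some \<open>V n\<close> is large is a
    countable union, hence measurable.\<close>
  define V where "V n \<omega> = (\<Sum>i<N n. \<bar>A (t n (Suc i)) \<omega> - A (t n i) \<omega>\<bar>)" for n \<omega>
  have [measurable]: "V n \<in> borel_measurable M" for n
    unfolding V_def by measurable
  have "(\<lambda>k. prob {\<omega> \<in> space M. \<exists>n. real k \<le> V n \<omega>}) \<longlonglongrightarrow> 0"
  proof (rule prob_tendsto_0)
    show "AE \<omega> in M. eventually (\<lambda>k. \<omega> \<notin> {\<omega> \<in> space M. \<exists>n. real k \<le> V n \<omega>}) sequentially"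
      using FV
    proof eventually_elim
      case (elim \<omega>)
      then obtain B where B: "\<And>u n. incseq u \<Longrightarrow> range u \<subseteq> {0..T} \<Longrightarrow>
          (\<Sum>i<n. \<bar>A (u (Suc i)) \<omega> - A (u i) \<omega>\<bar>) \<le> B"
        using T unfolding finite_variation_def by blast
      have VB: "V n \<omega> \<le> B" for n
        unfolding V_def using t by (intro B) auto
      have "eventually (\<lambda>k. B < real k) sequentially"
        using filterlim_real_sequentially by (auto simp: filterlim_at_top_dense)
      then show ?case
      proof eventually_elim
        case (elim k)
        then have "V n \<omega> < real k" for n
          using VB[of n] by linarith
        then show ?case
          by (simp add: not_le)
      qed
    qed
  qed measurable
  then have "eventually (\<lambda>k. prob {\<omega> \<in> space M. \<exists>n. real k \<le> V n \<omega>} < \<epsilon> / 3) sequentially"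
    using \<epsilon> by (intro order_tendstoD(2)) auto
  then obtain k :: nat where k: "prob {\<omega> \<in> space M. \<exists>n. real k \<le> V n \<omega>} < \<epsilon> / 3"
    by (auto simp: eventually_sequentially)

  define Y where "Y s \<omega> = L (min s (\<tau> m \<omega>)) \<omega> - L 0 \<omega>" for s \<omega>
  have Y: "\<And>s. s \<ge> 0 \<Longrightarrow> Y s \<in> borel_measurable (F s)" "\<And>s. s \<ge> 0 \<Longrightarrow> integrable M (Y s)"
    "\<And>s u. 0 \<le> s \<Longrightarrow> s \<le> u \<Longrightarrow> AE \<omega> in M. real_cond_exp M (F s) (Y u) \<omega> = Y s \<omega>"
    using \<tau>(3)[of m] unfolding martingale_def adapted_def Y_def by auto
  \<comment> \<open>The absolute value of the stopped martingale has nondecreasing expectation, so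
    its value at \<open>T\<close> bounds all earlier ones.\<close>
  define C where "C = expectation (\<lambda>\<omega>. \<bar>Y T \<omega>\<bar>)"
  have YC: "expectation (\<lambda>\<omega>. \<bar>Y s \<omega>\<bar>) \<le> C" if "0 \<le> s" "s \<le> T" for s
    unfolding C_def using that Y T sub by (intro expectation_abs_cond_exp_le[where F = "F s"]) auto
  have C: "C \<ge> 0"
    unfolding C_def by simp
  \<comment> \<open>The weak type inequality will give 4 C / K, since the increment over the whole
    grid has first absolute moment at most 2 C. The summand 1 keeps \<open>K\<close> positive when C
    = 0.\<close>
  define K where "K = 12 * C / \<epsilon> + 1"
  have K: "K > 0" "4 * C / K \<le> \<epsilon> / 3"
    using C \<epsilon> by (auto simp: K_def field_simps add_nonneg_pos)
  have weak: "prob {\<omega> \<in> space M. K \<le> \<bar>\<Sum>i<N n. H n i \<omega> * (Y (t n (Suc i)) \<omega> - Y (t n i) \<omega>)\<bar>} \<le> \<epsilon> / 3"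
    (is "prob ?W \<le> _") for n
  proof -
    have "prob ?W \<le> 2 * expectation (\<lambda>\<omega>. \<bar>Y (t n (N n)) \<omega> - Y (t n 0) \<omega>\<bar>) / K"
    proof (rule martingale_transform_weak_type[where F = "\<lambda>i. F (t n i)" and X = "\<lambda>i. Y (t n i)"])
      show "subalgebra (F (t n (Suc i))) (F (t n i))" for i
        using t(1) space_F sets_F_mono by (auto simp: subalgebra_def mono_def)
      show "AE \<omega> in M. real_cond_exp M (F (t n i)) (Y (t n (Suc i))) \<omega> = Y (t n i) \<omega>" for i
        using t(1) t0 by (intro Y(3)) (auto simp: mono_def)
    qed (use sub Y t0 H K in auto)
    also have "expectation (\<lambda>\<omega>. \<bar>Y (t n (N n)) \<omega> - Y (t n 0) \<omega>\<bar>)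
        \<le> expectation (\<lambda>\<omega>. \<bar>Y (t n (N n)) \<omega>\<bar> + \<bar>Y (t n 0) \<omega>\<bar>)"
      using Y(2)[OF t0(1)] by (intro integral_mono) auto
    also have "\<dots> = expectation (\<lambda>\<omega>. \<bar>Y (t n (N n)) \<omega>\<bar>) + expectation (\<lambda>\<omega>. \<bar>Y (t n 0) \<omega>\<bar>)"
      using Y(2)[OF t0(1)] by (intro Bochner_Integration.integral_add) auto
    also have "\<dots> \<le> 2 * C"
      using YC[OF t0, of n "N n"] YC[OF t0, of n 0] by simp
    finally show ?thesis
      using K by (simp add: divide_right_mono)
  qed

  show thesis
  proof (rule that)
    \<comment> \<open>The level is split: \<open>K\<close> for the stopped martingale part,
      \<open>k\<close> for the finite variation part.\<close>
    show "K + real k > 0"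
      using K by simp
  next
    fix n
    have Y_meas [measurable]: "Y (t n i) \<in> borel_measurable M" for i
      using Y(1)[OF t0(1)] by (rule measurable_from_subalg[OF sub])
    let ?S = "\<lambda>X \<omega>. \<Sum>i<N n. H n i \<omega> * (X (t n (Suc i)) \<omega> - X (t n i) \<omega>)"
    let ?E = "{\<omega> \<in> space M. \<tau> m \<omega> \<le> T}" and ?D = "{\<omega> \<in> space M. \<exists>n. real k \<le> V n \<omega>}"
    have "prob {\<omega> \<in> space M. K + real k \<le> \<bar>?S X \<omega>\<bar>} \<le> prob (?E \<union> ({\<omega> \<in> space M. K \<le> \<bar>?S Y \<omega>\<bar>} \<union> ?D))"
    proof (rule finite_measure_mono_AE)
      show "AE \<omega> in M. \<omega> \<in> {\<omega> \<in> space M. K + real k \<le> \<bar>?S X \<omega>\<bar>} \<longrightarrow>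
          \<omega> \<in> ?E \<union> ({\<omega> \<in> space M. K \<le> \<bar>?S Y \<omega>\<bar>} \<union> ?D)"
        using XLA
      proof eventually_elim
        case (elim \<omega>)
        have False if \<omega>: "\<omega> \<in> space M" and big: "K + real k \<le> \<bar>?S X \<omega>\<bar>" and "T < \<tau> m \<omega>"
          and small: "\<bar>?S Y \<omega>\<bar> < K" "V n \<omega> < real k"
        proof -
          \<comment> \<open>When \<open>\<tau> m\<close> exceeds \<open>T\<close>, stopping has no
            effect on the grid, and \<open>L 0\<close> cancels in the increments.\<close>
          have "Y (t n i) \<omega> = L (t n i) \<omega> - L 0 \<omega>" for i
            using t0(2)[of n i] \<open>T < \<tau> m \<omega>\<close> by (simp add: Y_def min_def)
          then have "X (t n i) \<omega> = Y (t n i) \<omega> + L 0 \<omega> + A (t n i) \<omega>" for i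
            using elim t0 by simp
          then have "?S X \<omega> = ?S Y \<omega> + ?S A \<omega>"
            unfolding sum.distrib[symmetric] by (intro sum.cong) (simp_all add: algebra_simps)
          moreover have "\<bar>?S A \<omega>\<bar> \<le> V n \<omega>"
            unfolding V_def using H(2)
            by (intro order_trans[OF sum_abs] sum_mono) (auto simp: abs_mult mult_left_le_one_le)
          ultimately show False
            using big small by linarith
        qed
        then show ?case
          by (auto simp: not_le[symmetric])
      qed
    qed measurable
    also have "\<dots> \<le> prob ?E + (prob {\<omega> \<in> space M. K \<le> \<bar>?S Y \<omega>\<bar>} + prob ?D)"
      by (intro order_trans[OF measure_Un_le] add_left_mono measure_Un_le) measurable
    also have "\<dots> \<le> \<epsilon>"
      using m k weak[of n] by simp
    finally show "prob {\<omega> \<in> space M. K + real k \<le> \<bar>?S X \<omega>\<bar>} \<le> \<epsilon>" .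
  qed
qed

subsection \<open>Gaussian moments\<close>

lemma gaussian_rv_integrable_power2:
  assumes "prob_space M" "gaussian_rv M Y"
  shows "integrable M (\<lambda>\<omega>. (Y \<omega>)\<^sup>2)"
proof -
  interpret prob_space M by fact
  have [measurable]: "Y \<in> borel_measurable M"
    using assms(2) by (simp add: gaussian_rv_def)
  consider \<mu> \<sigma> where "\<sigma> > 0" "distributed M lborel Y (normal_density \<mu> \<sigma>)"
    | \<mu> where "AE \<omega> in M. Y \<omega> = \<mu>"
    using assms(2) unfolding gaussian_rv_def by blast
  then show ?thesis
  proof cases
    case 1
    let ?f = "\<lambda>x k. normal_density \<mu> \<sigma> x * (x - \<mu>) ^ k"
    \<comment> \<open>Expansion of x^2 around the mean, reducing to central moments.\<close>
    have "integrable lborel (\<lambda>x. ?f x 2 + 2 * \<mu> * ?f x 1 + \<mu>\<^sup>2 * ?f x 0)"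
      using integrable_normal_moment[OF 1(1)] by (intro Bochner_Integration.integrable_add integrable_mult_right)
    also have "(\<lambda>x. ?f x 2 + 2 * \<mu> * ?f x 1 + \<mu>\<^sup>2 * ?f x 0) = (\<lambda>x. normal_density \<mu> \<sigma> x * x\<^sup>2)"
      by (simp add: fun_eq_iff power2_eq_square algebra_simps)
    finally show ?thesis
      using distributed_integrable[OF 1(2), of "\<lambda>x. x\<^sup>2"] by simp
  next
    case 2
    then have "AE \<omega> in M. (Y \<omega>)\<^sup>2 = \<mu>\<^sup>2"
      by eventually_elim simp
    then show ?thesis
      by (subst integrable_cong_AE[where g = "\<lambda>_. \<mu>\<^sup>2"]) auto
  qed
qed

text \<open>For positive variance the first absolute moment is
  \<open>\<sigma> * sqrt (2 / pi)\<close>, and 1/2 is a convenient lower bound for the factor. In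
  the degenerate case mean zero forces \<open>Y\<close> to vanish almost everywhere.\<close>

lemma centered_gaussian_expectation_abs_ge:
  assumes "prob_space M" "gaussian_rv M Y" "integral\<^sup>L M Y = 0"
  shows "sqrt (integral\<^sup>L M (\<lambda>\<omega>. (Y \<omega>)\<^sup>2)) / 2 \<le> integral\<^sup>L M (\<lambda>\<omega>. \<bar>Y \<omega>\<bar>)"
proof -
  interpret prob_space M by fact
  have [measurable]: "Y \<in> borel_measurable M"
    using assms(2) by (simp add: gaussian_rv_def)
  consider \<mu> \<sigma> where "\<sigma> > 0" "distributed M lborel Y (normal_density \<mu> \<sigma>)"
    | \<mu> where "AE \<omega> in M. Y \<omega> = \<mu>"
    using assms(2) unfolding gaussian_rv_def by blast
  then show ?thesis
  proof cases
    case 1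
    have "\<mu> = 0"
      using distributed_integral[OF 1(2), of "\<lambda>x. x"] integral_normal_moment_nz_1[OF 1(1)] assms(3)
      by simp
    then have "expectation (\<lambda>\<omega>. (Y \<omega>)\<^sup>2) = \<sigma>\<^sup>2" "expectation (\<lambda>\<omega>. \<bar>Y \<omega>\<bar>) = \<sigma> * sqrt (2 / pi)"
      using distributed_integral[OF 1(2), of "\<lambda>x. x\<^sup>2"] integral_normal_moment_even[OF 1(1), of 0 1]
        distributed_integral[OF 1(2), of "\<lambda>x. \<bar>x\<bar>"] integral_normal_moment_abs_odd[OF 1(1), of 0 0]
      by auto
    moreover have "1 / 2 \<le> sqrt (2 / pi)"
      using pi_less_4 by (intro real_le_rsqrt) (simp add: power2_eq_square field_simps)
    ultimately show ?thesis
      using 1(1) mult_left_mono[of "1 / 2" "sqrt (2 / pi)" \<sigma>] by simp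
  next
    case 2
    then have "expectation Y = expectation (\<lambda>_. \<mu>)"
      by (intro integral_cong_AE) auto
    then have "\<mu> = 0"
      using assms(3) by (simp add: prob_space)
    with 2 have "AE \<omega> in M. (Y \<omega>)\<^sup>2 = 0"
      by auto
    then have "expectation (\<lambda>\<omega>. (Y \<omega>)\<^sup>2) = expectation (\<lambda>_. 0)"
      by (intro integral_cong_AE) auto
    then show ?thesis
      by simp
  qed
qed

text \<open>
  Off \<open>E\<close>, \<open>\<bar>Z\<bar>\<close> still contributes at least \<open>3\<sigma>/8\<close> to its expectation, because the
  latter is at least \<open>\<sigma>/2\<close> and \<open>\<bar>Z\<bar> \<le> Z\<^sup>2/(16\<sigma>) + 4\<sigma>\<close> on \<open>E\<close>.
\<close>

lemma gaussian_sum_abs_bound: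
  fixes Z :: "nat \<Rightarrow> 'a \<Rightarrow> real"
  assumes "prob_space M" and Z: "\<And>i. i < n \<Longrightarrow> gaussian_rv M (Z i)" "\<And>i. i < n \<Longrightarrow> integral\<^sup>L M (Z i) = 0"
    and E: "E \<in> sets M" "measure M E \<le> 1 / 64"
    and bound: "\<And>\<omega>. \<omega> \<in> space M - E \<Longrightarrow> (\<Sum>i<n. \<bar>Z i \<omega>\<bar>) \<le> K" and "K \<ge> 0"
  shows "3 / 8 * (\<Sum>i<n. sqrt (integral\<^sup>L M (\<lambda>\<omega>. (Z i \<omega>)\<^sup>2))) \<le> K"
proof -
  interpret prob_space M by fact
  have [measurable]: "E \<in> events" "\<And>i. i < n \<Longrightarrow> Z i \<in> borel_measurable M"
    using E Z by (auto simp: gaussian_rv_def)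
  let ?G = "\<lambda>i \<omega>. \<bar>Z i \<omega>\<bar> * indicator (space M - E) \<omega>"
  have Zint: "integrable M (Z i)" "integrable M (\<lambda>\<omega>. (Z i \<omega>)\<^sup>2)" if "i < n" for i
    using that gaussian_rv_integrable_power2[OF assms(1) Z(1)[OF that]]
    by (auto intro: square_integrable_imp_integrable)
  have Gint: "integrable M (?G i)" if "i < n" for i
    using Zint(1)[OF that] that by (intro integrable_real_mult_indicator integrable_abs) auto
  have one: "3 / 8 * sqrt (expectation (\<lambda>\<omega>. (Z i \<omega>)\<^sup>2)) \<le> expectation (?G i)" if i: "i < n" for i
  proof -
    define \<sigma> where "\<sigma> = sqrt (expectation (\<lambda>\<omega>. (Z i \<omega>)\<^sup>2))"
    have \<sigma>2: "expectation (\<lambda>\<omega>. (Z i \<omega>)\<^sup>2) = \<sigma>\<^sup>2" and \<sigma>0: "\<sigma> \<ge> 0"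
      by (simp_all add: \<sigma>_def)
    show ?thesis
    proof (cases "\<sigma> = 0")
      case True
      then show ?thesis
        using \<sigma>2 by simp
    next
      case False
      with \<sigma>0 have \<sigma>: "\<sigma> > 0" by simp
      \<comment> \<open>The weight 8 in the square balances the losses: as \<open>E\<close> has
        probability at most 1/64, each of the last two terms has expectation at most
        \<open>\<sigma> / 16\<close>, leaving 3/8 of the initial
        \<open>\<sigma> / 2 = 4 * \<sigma> / 8\<close>.\<close>
      have am: "\<bar>Z i \<omega>\<bar> \<le> ?G i \<omega> + ((Z i \<omega>)\<^sup>2 / (16 * \<sigma>) + 4 * \<sigma> * indicator E \<omega>)"
        if "\<omega> \<in> space M" for \<omega>
      proof -
        have "0 \<le> (\<bar>Z i \<omega>\<bar> - 8 * \<sigma>)\<^sup>2" by simp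
        then have "16 * \<sigma> * \<bar>Z i \<omega>\<bar> \<le> (Z i \<omega>)\<^sup>2 + 64 * \<sigma>\<^sup>2"
          by (simp add: power2_diff power_mult_distrib mult.assoc mult.left_commute mult.commute)
        then have "\<bar>Z i \<omega>\<bar> \<le> (Z i \<omega>)\<^sup>2 / (16 * \<sigma>) + 4 * \<sigma>"
          using \<sigma> by (simp add: field_simps power2_eq_square)
        then show ?thesis
          using that \<sigma> by (auto simp: indicator_def)
      qed
      have "\<sigma> / 2 \<le> expectation (\<lambda>\<omega>. \<bar>Z i \<omega>\<bar>)"
        using centered_gaussian_expectation_abs_ge[OF assms(1) Z(1)[OF i] Z(2)[OF i]] by (simp add: \<sigma>_def)
      also have "\<dots> \<le> expectation (\<lambda>\<omega>. ?G i \<omega> + ((Z i \<omega>)\<^sup>2 / (16 * \<sigma>) + 4 * \<sigma> * indicator E \<omega>))"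
        using am Zint[OF i] Gint[OF i]
        by (intro integral_mono Bochner_Integration.integrable_add) (auto simp: emeasure_eq_measure)
      also have "\<dots> = expectation (?G i) + (\<sigma>\<^sup>2 / (16 * \<sigma>) + 4 * \<sigma> * prob E)"
        using Zint[OF i] Gint[OF i] E(1)
        by (simp add: Bochner_Integration.integral_add emeasure_eq_measure \<sigma>2)
      also have "\<sigma>\<^sup>2 / (16 * \<sigma>) = \<sigma> / 16"
        using \<sigma> by (simp add: power2_eq_square)
      also have "4 * \<sigma> * prob E \<le> 4 * \<sigma> * (1 / 64)"
        using E(2) \<sigma> by (intro mult_left_mono) auto
      finally show ?thesis
        by (simp add: \<sigma>_def)
    qed
  qed
  have "3 / 8 * (\<Sum>i<n. sqrt (expectation (\<lambda>\<omega>. (Z i \<omega>)\<^sup>2))) \<le> (\<Sum>i<n. expectation (?G i))"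
    unfolding sum_distrib_left using one by (intro sum_mono) auto
  also have "\<dots> = expectation (\<lambda>\<omega>. \<Sum>i<n. ?G i \<omega>)"
    using Gint by (intro Bochner_Integration.integral_sum[symmetric]) auto
  \<comment> \<open>On \<open>E\<close> the truncated sum is 0, which is where
    \<open>K \<ge> 0\<close> enters.\<close>
  also have "\<dots> \<le> expectation (\<lambda>_. K)"
    using Gint bound \<open>K \<ge> 0\<close>
    by (intro integral_mono Bochner_Integration.integrable_sum)
      (auto simp: indicator_def sum_distrib_right[symmetric])
  finally show ?thesis
    by (simp add: prob_space)
qed

text \<open>All mixed products are integrable by |ab| <= a^2 + b^2, so the square may be expanded
  under the integral.\<close>

lemma expectation_sum_power2:
  fixes Y :: "nat \<Rightarrow> 'a \<Rightarrow> real"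
  assumes int: "\<And>i. i < n \<Longrightarrow> integrable M (\<lambda>\<omega>. (Y i \<omega>)\<^sup>2)" and [measurable]: "\<And>i. i < n \<Longrightarrow> Y i \<in> borel_measurable M"
  shows "integral\<^sup>L M (\<lambda>\<omega>. (\<Sum>i<n. c i * Y i \<omega>)\<^sup>2) =
           (\<Sum>i<n. \<Sum>j<n. c i * c j * integral\<^sup>L M (\<lambda>\<omega>. Y i \<omega> * Y j \<omega>))"
    and "integrable M (\<lambda>\<omega>. (\<Sum>i<n. c i * Y i \<omega>)\<^sup>2)"
proof -
  have prod: "integrable M (\<lambda>\<omega>. Y i \<omega> * Y j \<omega>)" if "i < n" "j < n" for i j
  proof (rule Bochner_Integration.integrable_bound)
    show "integrable M (\<lambda>\<omega>. (Y i \<omega>)\<^sup>2 + (Y j \<omega>)\<^sup>2)"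
      using int that by auto
    have "\<bar>Y i \<omega> * Y j \<omega>\<bar> \<le> (Y i \<omega>)\<^sup>2 + (Y j \<omega>)\<^sup>2" for \<omega>
      using sum_squares_bound[of "\<bar>Y i \<omega>\<bar>" "\<bar>Y j \<omega>\<bar>"] abs_ge_zero[of "Y i \<omega> * Y j \<omega>"]
      unfolding abs_mult power2_abs by linarith
    then show "AE \<omega> in M. norm (Y i \<omega> * Y j \<omega>) \<le> norm ((Y i \<omega>)\<^sup>2 + (Y j \<omega>)\<^sup>2)"
      by simp
  qed (use that in measurable)
  have eq: "(\<Sum>i<n. c i * Y i \<omega>)\<^sup>2 = (\<Sum>i<n. \<Sum>j<n. c i * c j * (Y i \<omega> * Y j \<omega>))" for \<omega>
    by (simp add: power2_eq_square sum_product algebra_simps)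
  show "integral\<^sup>L M (\<lambda>\<omega>. (\<Sum>i<n. c i * Y i \<omega>)\<^sup>2) =
           (\<Sum>i<n. \<Sum>j<n. c i * c j * integral\<^sup>L M (\<lambda>\<omega>. Y i \<omega> * Y j \<omega>))"
  proof -
    have "integral\<^sup>L M (\<lambda>\<omega>. \<Sum>i<n. \<Sum>j<n. c i * c j * (Y i \<omega> * Y j \<omega>)) =
        (\<Sum>i<n. integral\<^sup>L M (\<lambda>\<omega>. \<Sum>j<n. c i * c j * (Y i \<omega> * Y j \<omega>)))"
      using prod by (intro Bochner_Integration.integral_sum Bochner_Integration.integrable_sum integrable_mult_right) auto
    also have "\<dots> = (\<Sum>i<n. \<Sum>j<n. integral\<^sup>L M (\<lambda>\<omega>. c i * c j * (Y i \<omega> * Y j \<omega>)))"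
      using prod by (intro sum.cong refl Bochner_Integration.integral_sum integrable_mult_right) auto
    finally show ?thesis
      unfolding eq by simp
  qed
  show "integrable M (\<lambda>\<omega>. (\<Sum>i<n. c i * Y i \<omega>)\<^sup>2)"
    unfolding eq using prod by (intro Bochner_Integration.integrable_sum integrable_mult_right) auto
qed

subsection \<open>Increments of the process\<close>

definition sq_ln :: "real \<Rightarrow> real" where "sq_ln x = x\<^sup>2 * ln x"

lemma sq_ln_0 [simp]: "sq_ln 0 = 0"
  by (simp add: sq_ln_def)

text \<open>The scaling law that makes sq_ln(2h) - 4 sq_ln(h) of order h^2: the logarithms of h
  cancel.\<close>

lemma sq_ln_double: "x > 0 \<Longrightarrow> sq_ln (2 * x) = 4 * (ln 2 * x\<^sup>2) + 4 * sq_ln x"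
  by (simp add: sq_ln_def ln_mult algebra_simps)

text \<open>In the variance of a combination with coefficients summing to 0 the one-variable terms
  drop out. The sums s + t then stay away from the singularity at 0, and only the lags |s - t|
  approach it.\<close>

lemma R_eq_sq_ln: "R s t = (sq_ln (s + t) + sq_ln \<bar>s - t\<bar>) / 2 - sq_ln s - sq_ln t"
  by (simp add: R_def sq_ln_def)

text \<open>The second derivative 2 ln x + 3 lies between 0 and 7 on [1, 7]. Both bounds are
  midpoint convexity, of \<open>sq_ln\<close> and of 7/2 x^2 - \<open>sq_ln\<close>; the second
  difference of 7/2 x^2 is exactly 7 h^2.\<close>

lemma sq_ln_second_difference:
  assumes "1 \<le> a" "h \<ge> 0" "a + 2 * h \<le> 7"
  shows "0 \<le> sq_ln a - 2 * sq_ln (a + h) + sq_ln (a + 2 * h)"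
    and "sq_ln a - 2 * sq_ln (a + h) + sq_ln (a + 2 * h) \<le> 7 * h\<^sup>2"
proof -
  have mid: "a + h = (1 - 1 / 2) *\<^sub>R a + (1 / 2) *\<^sub>R (a + 2 * h)"
    by (simp add: field_simps)
  have "convex_on {1..7} sq_ln"
  proof (rule f''_ge0_imp_convex)
    fix x :: real assume x: "x \<in> {1..7}"
    show "(sq_ln has_real_derivative 2 * x * ln x + x) (at x)"
      unfolding sq_ln_def using x
      by (auto intro!: derivative_eq_intros simp: field_simps power2_eq_square)
    show "((\<lambda>x. 2 * x * ln x + x) has_real_derivative 2 * ln x + 3) (at x)"
      using x by (auto intro!: derivative_eq_intros)
    show "0 \<le> 2 * ln x + 3"
      using x by simp
  qed simp
  from convex_onD[OF this, of "1 / 2" a "a + 2 * h"] assms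
  show "0 \<le> sq_ln a - 2 * sq_ln (a + h) + sq_ln (a + 2 * h)"
    unfolding mid[symmetric] by simp
  have "convex_on {1..7} (\<lambda>x. 7 / 2 * x\<^sup>2 - sq_ln x)"
  proof (rule f''_ge0_imp_convex)
    fix x :: real assume x: "x \<in> {1..7}"
    show "((\<lambda>x. 7 / 2 * x\<^sup>2 - sq_ln x) has_real_derivative 7 * x - (2 * x * ln x + x)) (at x)"
      unfolding sq_ln_def using x
      by (auto intro!: derivative_eq_intros simp: field_simps power2_eq_square)
    show "((\<lambda>x. 7 * x - (2 * x * ln x + x)) has_real_derivative 4 - 2 * ln x) (at x)"
      using x by (auto intro!: derivative_eq_intros)
    \<comment> \<open>Since 2.7 <= e and 2.7^2 = 7.29, it follows that ln 7 <= 2.\<close>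
    have "(7 :: real) \<le> (27 / 10)\<^sup>2"
      by (simp add: power2_eq_square)
    also have "\<dots> \<le> (exp 1)\<^sup>2"
    proof (rule power_mono)
      show "27 / 10 \<le> exp (1 :: real)"
        using e_approx_32 unfolding abs_le_iff by simp
    qed simp
    also have "\<dots> = exp 2"
      by (simp add: exp_double[symmetric])
    finally have "x \<le> exp 2"
      using x by simp
    then have "ln x \<le> 2"
      using x ln_le_cancel_iff[of x "exp 2"] by simp
    then show "0 \<le> 4 - 2 * ln x"
      by simp
  qed simp
  from convex_onD[OF this, of "1 / 2" a "a + 2 * h"] assms
  have "7 / 2 * (a + h)\<^sup>2 - sq_ln (a + h) \<le>
      (7 / 2 * a\<^sup>2 - sq_ln a) / 2 + (7 / 2 * (a + 2 * h)\<^sup>2 - sq_ln (a + 2 * h)) / 2"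
    unfolding mid[symmetric] by simp
  then show "sq_ln a - 2 * sq_ln (a + h) + sq_ln (a + 2 * h) \<le> 7 * h\<^sup>2"
    by (simp add: power2_eq_square field_simps)
qed

text \<open>The right-hand side is half the second difference of \<open>sq_ln\<close> at 2t,
  nonnegative by convexity, minus sq_ln(h), which is the logarithmic term.\<close>

lemma R_increment_ge:
  assumes "1 \<le> t" "t \<le> 2" "0 < h" "h \<le> 1"
  shows "h\<^sup>2 * ln (1 / h) \<le> R (t + h) (t + h) - 2 * R (t + h) t + R t t"
proof -
  have "0 \<le> sq_ln (2 * t) - 2 * sq_ln (2 * t + h) + sq_ln (2 * t + 2 * h)"
    using assms by (intro sq_ln_second_difference) auto
  moreover have "2 * t + 2 * h = 2 * (t + h)" "t + h + t = 2 * t + h" by simp_all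
  moreover have "h\<^sup>2 * ln (1 / h) = - sq_ln h"
    using assms by (simp add: sq_ln_def ln_div)
  ultimately show ?thesis
    using assms by (simp add: R_eq_sq_ln mult_2[symmetric] del: distrib_left_numeral)
qed

text \<open>The logarithmic singularities cancel in the variance of a second difference.\<close>

lemma R_second_difference_le:
  assumes "1 \<le> t" "t \<le> 2" "0 < h" "h \<le> 1 / 2"
  shows "R t t + 4 * R (t + h) (t + h) + R (t + 2 * h) (t + 2 * h)
      - 4 * R t (t + h) + 2 * R t (t + 2 * h) - 4 * R (t + h) (t + 2 * h) \<le> 25 * h\<^sup>2"
proof -
  define \<delta> where "\<delta> a = sq_ln a - 2 * sq_ln (a + h) + sq_ln (a + 2 * h)" for a
  have h4: "2 * t + h + 2 * h \<le> 7" "2 * t + 2 * h + 2 * h \<le> 7"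
    using assms by linarith+
  have "\<delta> (2 * t) \<le> 7 * h\<^sup>2" "0 \<le> \<delta> (2 * t + h)" "\<delta> (2 * t + 2 * h) \<le> 7 * h\<^sup>2"
    using assms h4 unfolding \<delta>_def by (intro sq_ln_second_difference; linarith)+
  moreover have "sq_ln (2 * h) \<le> 4 * h\<^sup>2 + 4 * sq_ln h"
    using assms sq_ln_double[of h] mult_right_mono[of "ln 2" 1 "h\<^sup>2"] ln_2_less_1 by simp
  moreover have "R t t + 4 * R (t + h) (t + h) + R (t + 2 * h) (t + 2 * h)
      - 4 * R t (t + h) + 2 * R t (t + 2 * h) - 4 * R (t + h) (t + 2 * h) =
      \<delta> (2 * t) / 2 - \<delta> (2 * t + h) + \<delta> (2 * t + 2 * h) / 2 + sq_ln (2 * h) - 4 * sq_ln h"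
  proof -
    have eqs: "t + t = 2 * t" "t + h + (t + h) = 2 * t + 2 * h" "t + 2 * h + (t + 2 * h) = 2 * t + 4 * h"
      "t + (t + h) = 2 * t + h" "t + (t + 2 * h) = 2 * t + 2 * h" "t + h + (t + 2 * h) = 2 * t + 3 * h"
      "\<bar>t - (t + h)\<bar> = h" "\<bar>t - (t + 2 * h)\<bar> = 2 * h" "\<bar>t + h - (t + 2 * h)\<bar> = h"
      "2 * t + h + h = 2 * t + 2 * h" "2 * t + h + 2 * h = 2 * t + 3 * h" "2 * t + 2 * h + h = 2 * t + 3 * h"
      "2 * t + 2 * h + 2 * h = 2 * t + 4 * h"
      using assms by auto
    show ?thesis
      unfolding R_eq_sq_ln \<delta>_def eqs diff_self abs_zero sq_ln_0 by (simp add: field_simps)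
  qed
  \<comment> \<open>The bounds add up to 7/2 + 0 + 7/2 + 4 = 11 times h^2, within the claimed
    25.\<close>
  ultimately show ?thesis
    using zero_le_power2[of h] by linarith
qed


section \<open>Moments of the increments of the Gaussian process\<close>

context
  fixes M :: "'a measure" and X :: "real \<Rightarrow> 'a \<Rightarrow> real"
  assumes prob: "prob_space M" and cgp: "centered_gaussian_process M X R"
begin

lemma gaussian_increment:
  assumes "0 \<le> s" "0 \<le> t"
  shows "gaussian_rv M (X s)" "gaussian_rv M (\<lambda>\<omega>. X t \<omega> - X s \<omega>)"
proof -
  have *: "gaussian_rv M (\<lambda>\<omega>. \<Sum>t\<in>S. c t * X t \<omega>)" if "finite S" "S \<subseteq> {0..}" for S c
    using cgp that by (simp add: centered_gaussian_process_def gaussian_process_def)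
  show "gaussian_rv M (X s)"
    using *[of "{s}" "\<lambda>_. 1"] assms by simp
  show "gaussian_rv M (\<lambda>\<omega>. X t \<omega> - X s \<omega>)"
  \<comment> \<open>For s = t the set \<open>{s, t}\<close> collapses to one point, so the zero
    increment is taken as an empty sum.\<close>
  proof (cases "s = t")
    case True
    then show ?thesis
      using *[of "{}" "\<lambda>_. 1"] by simp
  next
    case False
    then show ?thesis
      using *[of "{s, t}" "\<lambda>u. if u = t then 1 else - 1"] assms by simp
  qed
qed

lemma gaussian_process_measurable: "0 \<le> s \<Longrightarrow> X s \<in> borel_measurable M"
  using gaussian_increment(1)[of s s] by (simp add: gaussian_rv_def)

lemma gaussian_process_integrable:
  assumes "0 \<le> s"
  shows "integrable M (\<lambda>\<omega>. (X s \<omega>)\<^sup>2)" "integrable M (X s)"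
proof -
  interpret prob_space M by (rule prob)
  show "integrable M (\<lambda>\<omega>. (X s \<omega>)\<^sup>2)"
    using gaussian_increment(1)[OF assms assms] by (rule gaussian_rv_integrable_power2[OF prob])
  then show "integrable M (X s)"
    using gaussian_process_measurable[OF assms] by (rule square_integrable_imp_integrable[rotated])
qed

lemma expectation_gaussian_sum_power2:
  fixes t :: "nat \<Rightarrow> real"
  assumes "\<And>i. i < n \<Longrightarrow> 0 \<le> t i"
  shows "integral\<^sup>L M (\<lambda>\<omega>. (\<Sum>i<n. c i * X (t i) \<omega>)\<^sup>2) = (\<Sum>i<n. \<Sum>j<n. c i * c j * R (t i) (t j))"
    and "integrable M (\<lambda>\<omega>. (\<Sum>i<n. c i * X (t i) \<omega>)\<^sup>2)"
proof -
  note * = expectation_sum_power2[where Y = "\<lambda>i. X (t i)", OF gaussian_process_integrable(1)[OF assms]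
      gaussian_process_measurable[OF assms], of n c]
  show "integral\<^sup>L M (\<lambda>\<omega>. (\<Sum>i<n. c i * X (t i) \<omega>)\<^sup>2) = (\<Sum>i<n. \<Sum>j<n. c i * c j * R (t i) (t j))"
    using cgp assms by (subst *(1)) (auto simp: centered_gaussian_process_def intro!: sum.cong)
  show "integrable M (\<lambda>\<omega>. (\<Sum>i<n. c i * X (t i) \<omega>)\<^sup>2)"
    by (rule *(2))
qed

lemma variance_increment_ge:
  assumes "1 \<le> t" "t \<le> 2" "0 < h" "h \<le> 1"
  shows "h\<^sup>2 * ln (1 / h) \<le> integral\<^sup>L M (\<lambda>\<omega>. (X (t + h) \<omega> - X t \<omega>)\<^sup>2)"
proof -
  have "integral\<^sup>L M (\<lambda>\<omega>. (\<Sum>i<2. (if i = 0 then - 1 else 1) * X (t + real i * h) \<omega>)\<^sup>2) =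
      R (t + h) (t + h) - 2 * R (t + h) t + R t t"
    using assms by (subst expectation_gaussian_sum_power2(1)) (auto simp: eval_nat_numeral R_eq_sq_ln algebra_simps)
  then show ?thesis
    using R_increment_ge[OF assms] by (simp add: eval_nat_numeral)
qed

text \<open>The variance bound 25 h^2 and |D| <= D^2 / (2h) + h / 2 give 25h/2 + h/2. Being linear
  in h, this sums to a constant over a grid of mesh h.\<close>

lemma expectation_abs_second_difference_le:
  assumes "1 \<le> t" "t \<le> 2" "0 < h" "h \<le> 1 / 2"
  shows "integral\<^sup>L M (\<lambda>\<omega>. \<bar>(X (t + 2 * h) \<omega> - X (t + h) \<omega>) - (X (t + h) \<omega> - X t \<omega>)\<bar>) \<le> 13 * h"
proof -
  interpret prob_space M by (rule prob)
  define D where "D \<omega> = (X (t + 2 * h) \<omega> - X (t + h) \<omega>) - (X (t + h) \<omega> - X t \<omega>)" for \<omega>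
  have D: "D \<omega> = (\<Sum>i<3. (if i = Suc 0 then - 2 else 1) * X (t + real i * h) \<omega>)" for \<omega>
    by (simp add: D_def eval_nat_numeral)
  have int: "integrable M (\<lambda>\<omega>. (D \<omega>)\<^sup>2)"
    unfolding D using assms by (intro expectation_gaussian_sum_power2(2)) auto
  have "expectation (\<lambda>\<omega>. (D \<omega>)\<^sup>2) = R t t + 4 * R (t + h) (t + h) + R (t + 2 * h) (t + 2 * h)
      - 4 * R t (t + h) + 2 * R t (t + 2 * h) - 4 * R (t + h) (t + 2 * h)"
    unfolding D using assms
    by (subst expectation_gaussian_sum_power2(1)) (auto simp: eval_nat_numeral R_eq_sq_ln field_simps)
  also have "\<dots> \<le> 25 * h\<^sup>2"
    by (rule R_second_difference_le[OF assms])
  finally have var: "expectation (\<lambda>\<omega>. (D \<omega>)\<^sup>2) \<le> 25 * h\<^sup>2" .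
  have "\<bar>D \<omega>\<bar> \<le> (D \<omega>)\<^sup>2 / (2 * h) + h / 2" for \<omega>
  proof -
    have "0 \<le> (\<bar>D \<omega>\<bar> - h)\<^sup>2" by simp
    then show ?thesis
      using assms by (simp add: power2_diff field_simps power2_eq_square)
  qed
  moreover have "integrable M D"
    unfolding D_def using assms
    by (intro Bochner_Integration.integrable_diff gaussian_process_integrable(2)) auto
  ultimately have "expectation (\<lambda>\<omega>. \<bar>D \<omega>\<bar>) \<le> expectation (\<lambda>\<omega>. (D \<omega>)\<^sup>2 / (2 * h) + h / 2)"
    using int by (intro integral_mono Bochner_Integration.integrable_add) auto
  also have "\<dots> = expectation (\<lambda>\<omega>. (D \<omega>)\<^sup>2) / (2 * h) + h / 2"
    using int by (subst Bochner_Integration.integral_add) (auto simp: prob_space)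
  also have "\<dots> \<le> 25 * h\<^sup>2 / (2 * h) + h / 2"
    using var assms by (intro add_right_mono divide_right_mono) auto
  also have "\<dots> = 13 * h"
    using assms by (simp add: power2_eq_square)
  finally show ?thesis
    by (simp add: D_def)
qed

end


section \<open>Contradiction along the grids in [1, 2]\<close>

theorem proposition3p5:
  fixes M :: "'a measure" and \<eta> :: "real \<Rightarrow> 'a \<Rightarrow> real"
  assumes "prob_space M"
    and "centered_gaussian_process M \<eta> R"
    and "\<forall>\<omega>\<in>space M. continuous_on {0..} (\<lambda>t. \<eta> t \<omega>)"
  shows "\<not> semimartingale M (natural_filtration M \<eta>) \<eta>"
proof
  assume semi: "semimartingale M (natural_filtration M \<eta>) \<eta>"
  interpret prob_space M by fact
  note meas = gaussian_process_measurable[OF assms(1,2)]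
  define h :: "nat \<Rightarrow> real" where "h n = 1 / real (Suc n)" for n
  \<comment> \<open>The cap at 2 makes each grid a monotone sequence in [0, 2] defined for all
    indices; up to index n + 1 it is inactive.\<close>
  define t :: "nat \<Rightarrow> nat \<Rightarrow> real" where "t n i = 1 + min 1 (real i * h n)" for n i
  define \<Delta> where "\<Delta> n i \<omega> = \<eta> (t n (Suc i)) \<omega> - \<eta> (t n i) \<omega>" for n i \<omega>
  \<comment> \<open>The lag by one index makes \<open>H n i\<close> known at time
    \<open>t n i\<close>; the first increment has no predecessor and gets weight 0.\<close>
  define H :: "nat \<Rightarrow> nat \<Rightarrow> 'a \<Rightarrow> real"
    where "H n i \<omega> = (case i of 0 \<Rightarrow> 0 | Suc j \<Rightarrow> sgn (\<Delta> n j \<omega>))" for n i \<omega>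
  have h: "0 < h n" "h n \<le> 1" for n
    by (auto simp: h_def)
  have t12: "1 \<le> t n i" "t n i \<le> 2" for n i
    using h[of n] by (auto simp: t_def)
  have t_mono: "t n i \<le> t n j" if "i \<le> j" for n i j
  proof -
    have "real i * h n \<le> real j * h n"
      using that h[of n] by (intro mult_right_mono) auto
    then show ?thesis by (simp add: t_def)
  qed
  have t_eq: "t n i = 1 + real i * h n" if "i \<le> Suc n" for n i
    using that by (simp add: t_def h_def divide_le_eq_1)
  have t_Suc: "t n (Suc i) = t n i + h n" if "i \<le> n" for n i
    using that by (simp add: t_eq algebra_simps)
  have \<eta>_nat: "\<eta> s \<in> borel_measurable (natural_filtration M \<eta> u)" if "0 \<le> s" "s \<le> u" for s u
  proof (rule measurableI)
    fix B :: "real set" assume "B \<in> sets borel"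
    then show "\<eta> s -` B \<inter> space (natural_filtration M \<eta> u) \<in> sets (natural_filtration M \<eta> u)"
      unfolding sets_natural_filtration space_natural_filtration
      using that by (intro sigma_sets.Basic) force
  qed simp
  \<comment> \<open>The probability 1/128 is half of the 1/64 allowed in
    \<open>gaussian_sum_abs_bound\<close>; the other half is spent on \<open>W\<close>.\<close>
  obtain K where K: "K > 0" "\<And>n. prob {\<omega> \<in> space M. K \<le> \<bar>\<Sum>i<Suc n. H n i \<omega> * \<Delta> n i \<omega>\<bar>} \<le> 1 / 128"
  proof (rule semimartingale_integrals_tight[OF assms(1) filtration_natural_filtration _ semi,
        where t = t and T = 2 and H = H and N = Suc and \<epsilon> = "1 / 128"])
    show "subalgebra M (natural_filtration M \<eta> s)" for s
      using meas by (rule subalgebra_natural_filtration)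
    show "H n i \<in> borel_measurable (natural_filtration M \<eta> (t n i))" for n i
    proof (cases i)
      case (Suc j)
      then have "\<eta> (t n i) \<in> borel_measurable (natural_filtration M \<eta> (t n i))"
        "\<eta> (t n j) \<in> borel_measurable (natural_filtration M \<eta> (t n i))"
        using t12(1)[of n i] t12(1)[of n j] t_mono[of j i n] by (auto intro!: \<eta>_nat)
      then show ?thesis
        unfolding H_def \<Delta>_def Suc by simp
    qed (simp add: H_def[abs_def])
    show "\<bar>H n i \<omega>\<bar> \<le> 1" for n i \<omega>
      by (auto simp: H_def sgn_if split: nat.splits)
  next
    fix K assume "K > 0"
      "\<And>n. prob {\<omega> \<in> space M. K \<le> \<bar>\<Sum>i<Suc n. H n i \<omega> * (\<eta> (t n (Suc i)) \<omega> - \<eta> (t n i) \<omega>)\<bar>} \<le> 1 / 128"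
    then show thesis
      by (intro that) (auto simp: \<Delta>_def)
  qed (use t12 t_mono order_trans[OF zero_le_one t12(1)] in \<open>auto simp: mono_def\<close>)

  have \<Delta>_meas [measurable]: "\<Delta> n i \<in> borel_measurable M" for n i
    unfolding \<Delta>_def using meas order_trans[OF zero_le_one t12(1)] by measurable
  have H_meas [measurable]: "H n i \<in> borel_measurable M" for n i
    unfolding H_def by (cases i) auto
  have \<Delta>_int: "integrable M (\<Delta> n i)" for n i
    unfolding \<Delta>_def using order_trans[OF zero_le_one t12(1)]
    by (intro Bochner_Integration.integrable_diff gaussian_process_integrable(2)[OF assms(1,2)])

  \<comment> \<open>The error made when each increment is replaced by its successor: n second
    differences, each with first absolute moment at most 13 h.\<close>
  define W where "W n \<omega> = (\<Sum>i<n. \<bar>\<Delta> n (Suc i) \<omega> - \<Delta> n i \<omega>\<bar>)" for n \<omega>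
  have W_meas [measurable]: "W n \<in> borel_measurable M" for n
    unfolding W_def by measurable
  have W_int: "integrable M (W n)" for n
    unfolding W_def[abs_def] using \<Delta>_int by auto
  have W_le: "expectation (W n) \<le> 13" for n
  proof -
    have "expectation (\<lambda>\<omega>. \<bar>\<Delta> n (Suc i) \<omega> - \<Delta> n i \<omega>\<bar>) \<le> 13 * h n" if i: "i < n" for i
    proof -
      \<comment> \<open>The existence of i < n excludes n = 0.\<close>
      have "h n \<le> 1 / 2"
        using i by (auto simp: h_def field_simps)
      moreover have "t n (Suc i) = t n i + h n" "t n (Suc (Suc i)) = t n i + 2 * h n"
        using t_Suc[of i n] t_Suc[of "Suc i" n] i by auto
      ultimately show ?thesis
        using expectation_abs_second_difference_le[OF assms(1,2) t12[of n i] h(1)[of n]]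
        by (simp add: \<Delta>_def)
    qed
    then have "(\<Sum>i<n. expectation (\<lambda>\<omega>. \<bar>\<Delta> n (Suc i) \<omega> - \<Delta> n i \<omega>\<bar>)) \<le> (\<Sum>i<n. 13 * h n)"
      by (intro sum_mono) auto
    also have "(\<Sum>i<n. 13 * h n) \<le> 13"
      by (simp add: h_def field_simps)
    also have "(\<Sum>i<n. expectation (\<lambda>\<omega>. \<bar>\<Delta> n (Suc i) \<omega> - \<Delta> n i \<omega>\<bar>)) = expectation (W n)"
      unfolding W_def[abs_def] using \<Delta>_int
      by (intro Bochner_Integration.integral_sum[symmetric] integrable_abs Bochner_Integration.integrable_diff)
    finally show ?thesis .
  qed
  \<comment> \<open>Markov's inequality with 1664 = 13 * 128.\<close>
  have W_prob: "prob {\<omega> \<in> space M. 1664 \<le> W n \<omega>} \<le> 1 / 128" for n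
  proof -
    have "prob {\<omega> \<in> space M. 1664 \<le> W n \<omega>} \<le> expectation (W n) / 1664"
    proof (rule integral_Markov_inequality_measure[where A = "{}"])
      show "AE \<omega> in M. 0 \<le> W n \<omega>"
        by (simp add: W_def sum_nonneg)
    qed (use W_int in auto)
    then show ?thesis
      using W_le[of n] by simp
  qed

  have bound: "3 / 8 * (\<Sum>i<n. sqrt (expectation (\<lambda>\<omega>. (\<Delta> n i \<omega>)\<^sup>2))) \<le> K + 1664" for n
  proof (rule gaussian_sum_abs_bound[OF assms(1)])
    let ?S = "\<lambda>\<omega>. \<Sum>i<Suc n. H n i \<omega> * \<Delta> n i \<omega>"
    let ?E = "{\<omega> \<in> space M. K \<le> \<bar>?S \<omega>\<bar>} \<union> {\<omega> \<in> space M. 1664 \<le> W n \<omega>}"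
    show "?E \<in> events"
      by measurable
    have "prob ?E \<le> prob {\<omega> \<in> space M. K \<le> \<bar>?S \<omega>\<bar>} + prob {\<omega> \<in> space M. 1664 \<le> W n \<omega>}"
      by (rule measure_Un_le) measurable
    then show "prob ?E \<le> 1 / 64"
      using K(2)[of n] W_prob[of n] by simp
    fix \<omega> assume \<omega>: "\<omega> \<in> space M - ?E"
    have "?S \<omega> = (\<Sum>i<n. sgn (\<Delta> n i \<omega>) * \<Delta> n (Suc i) \<omega>)"
      by (subst sum.lessThan_Suc_shift) (simp add: H_def)
    \<comment> \<open>Termwise |a| = sgn(a) b - sgn(a) (b - a) <= sgn(a) b + |b - a|, with b the
      increment following a.\<close>
    moreover have "(\<Sum>i<n. \<bar>\<Delta> n i \<omega>\<bar>) \<le>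
        (\<Sum>i<n. sgn (\<Delta> n i \<omega>) * \<Delta> n (Suc i) \<omega> + \<bar>\<Delta> n (Suc i) \<omega> - \<Delta> n i \<omega>\<bar>)"
      by (intro sum_mono) (auto simp: sgn_if)
    ultimately have "(\<Sum>i<n. \<bar>\<Delta> n i \<omega>\<bar>) \<le> ?S \<omega> + W n \<omega>"
      by (simp add: sum.distrib W_def)
    moreover have "\<bar>?S \<omega>\<bar> < K" "W n \<omega> < 1664"
      using \<omega> by auto
    ultimately show "(\<Sum>i<n. \<bar>\<Delta> n i \<omega>\<bar>) \<le> K + 1664"
      by linarith
  next
    fix i
    have t0: "0 \<le> t n i" "0 \<le> t n (Suc i)"
      using order_trans[OF zero_le_one t12(1)] by auto
    show "gaussian_rv M (\<Delta> n i)"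
      unfolding \<Delta>_def by (rule gaussian_increment(2)[OF assms(1,2) t0])
    show "expectation (\<Delta> n i) = 0"
      using assms(2) t0 gaussian_process_integrable(2)[OF assms(1,2)]
      unfolding \<Delta>_def by (simp add: centered_gaussian_process_def)
  qed (use K in auto)

  \<comment> \<open>Each standard deviation is at least h sqrt(ln(1/h)) with 1/h = n + 1, and n h =
    n/(n + 1) >= 1/2 for n > 0.\<close>
  have lower: "sqrt (ln (real (Suc n))) / 2 \<le> (\<Sum>i<n. sqrt (expectation (\<lambda>\<omega>. (\<Delta> n i \<omega>)\<^sup>2)))" if "n > 0" for n
  proof -
    have "h n * sqrt (ln (real (Suc n))) \<le> sqrt (expectation (\<lambda>\<omega>. (\<Delta> n i \<omega>)\<^sup>2))" if "i < n" for i
    proof -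
      have "(h n)\<^sup>2 * ln (1 / h n) \<le> expectation (\<lambda>\<omega>. (\<Delta> n i \<omega>)\<^sup>2)"
        using variance_increment_ge[OF assms(1,2) t12[of n i] h[of n]] t_Suc[of i n] that
        by (simp add: \<Delta>_def)
      then have "sqrt ((h n)\<^sup>2 * ln (1 / h n)) \<le> sqrt (expectation (\<lambda>\<omega>. (\<Delta> n i \<omega>)\<^sup>2))"
        by (rule real_sqrt_le_mono)
      then show ?thesis
        using h[of n] by (simp add: real_sqrt_mult h_def)
    qed
    then have "(\<Sum>i<n. h n * sqrt (ln (real (Suc n)))) \<le> (\<Sum>i<n. sqrt (expectation (\<lambda>\<omega>. (\<Delta> n i \<omega>)\<^sup>2)))"
      by (intro sum_mono) auto
    moreover have "1 / 2 * sqrt (ln (real (Suc n))) \<le> (real n * h n) * sqrt (ln (real (Suc n)))"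
      using that by (intro mult_right_mono) (auto simp: h_def field_simps)
    ultimately show ?thesis
      by simp
  qed
  \<comment> \<open>Chosen so that sqrt(ln(n + 1)) >= 6 (K + 1664): the standard deviations then add
    up to at least 3 (K + 1664), above the upper bound 8/3 (K + 1664).\<close>
  define n where "n = nat \<lceil>exp ((6 * (K + 1664))\<^sup>2)\<rceil>"
  have n: "exp ((6 * (K + 1664))\<^sup>2) \<le> real n"
    unfolding n_def by (rule real_nat_ceiling_ge)
  then have "n > 0"
    using exp_gt_zero[of "(6 * (K + 1664))\<^sup>2"] by (cases n) auto
  have "(6 * (K + 1664))\<^sup>2 = ln (exp ((6 * (K + 1664))\<^sup>2))"
    by simp
  also have "\<dots> \<le> ln (real (Suc n))"
    using n by (subst ln_le_cancel_iff) auto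
  finally have "6 * (K + 1664) \<le> sqrt (ln (real (Suc n)))"
    by (rule real_le_rsqrt)
  then have "3 * (K + 1664) \<le> (\<Sum>i<n. sqrt (expectation (\<lambda>\<omega>. (\<Delta> n i \<omega>)\<^sup>2)))"
    using lower[OF \<open>n > 0\<close>] by simp
  also have "\<dots> \<le> 8 / 3 * (K + 1664)"
    using bound[of n] by simp
  finally show False
    using K(1) by simp
qed

end
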